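(* Let $G=(V,E)$ be a finite simple connected graph with adjacency matrix $A_G$, and let $\lambda\in\mathbb{R}$ be a fixed nonzero scalar. Let $p_{\mathcal{A}_{G,\lambda}}$ be the adjacency blowup-polynomial. (1) Suppose $H\subset G$ is an induced subgraph. Then $$p_{\mathcal{A}_{H,\lambda}}(\{n_v:v\in V(H)\})=p_{\mathcal{A}_{G,\lambda}}(\mathbf{n})\big|_{n_v=0\ \forall v\in V(G)\setminus V(H)}\cdot\lambda^{|V(H)|-|V(G)|}.$$ (2) If $H,H'$ are isomorphic subgraphs inside $G$, then the coefficients in $p_{\mathcal{A}_{G,\lambda}}$ of the monomials corresponding to $V(H)$ and $V(H')$, namely $\prod_{v\in V(H)}n_v$ and $\prod_{v\in V(H')}n_v$, are equal. (3) Suppose for some non-empty subset $J\subset V(G)$ that the induced subgraph on $J$ contains a connected component which is a tree without a perfect matching. Then the coefficient of $\mathbf{n}^J:=\prod_{v\in J}n_v$ in $p_{\mathcal{A}_{G,\lambda}}(\mathbf{n})$ is zero. (4) If $\lambda=-1$, then up to a scalar, the univariate specialization $u_{\mathcal{A}_{G,-1}}(z):=p_{\mathcal{A}_{G,-1}}(z,\dots,z)$ is precisely the "inversion" of the characteristic polynomial $\chi_{A_G}$ of $A_G$: $u_{\mathcal{A}_{G,-1}}(z)=z^{|V|}\chi_{A_G}(z^{-1})$ (up to a scalar).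
   Context: For any finite simple graph $F$ with adjacency matrix $A_F$ and nonzero $\lambda\in\mathbb{R}$, set $\mathcal{A}_{F,\lambda}:=\lambda\operatorname{Id}_{V(F)}+A_F$. The adjacency blowup-polynomial is $p_{\mathcal{A}_{F,\lambda}}(\mathbf{n}):=\det(\lambda\operatorname{Id}_{V(F)}+\Delta_{\mathbf{n}}A_F)$ in the variables $\mathbf{n}=(n_v)_{v\in V(F)}$, where $\Delta_{\mathbf{n}}:=\operatorname{diag}(n_v)_{v\in V(F)}$. The characteristic polynomial is $\chi_{A_G}(x)=\det(x\operatorname{Id}_V-A_G)$.
   Formalization: In (2), H and H' are taken to be isomorphic induced subgraphs of G; for arbitrary subgraphs the claim fails (path a-b-c, edgeless subgraphs on {a,b} and {a,c}: coefficients -λ and 0). *)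

theory Defs
  imports
    "Graph_Theory.Digraph_Component"
    "Graph_Theory.Digraph_Isomorphism"
    "HOL-Analysis.Determinants"
    "HOL-Library.Poly_Mapping"
    "HOL-Computational_Algebra.Polynomial"
begin

text \<open>
  Finite simple graphs are the locale \<^locale>\<open>graph\<close> of Graph_Theory: finite, loop-free symmetric
  digraphs without parallel arcs, every undirected edge being a pair of opposite arcs.
\<close>

type_synonym 'v real_mpoly = "('v \<Rightarrow>\<^sub>0 nat) \<Rightarrow>\<^sub>0 real"

definition Const :: "real \<Rightarrow> 'v real_mpoly" where
  "Const c = Poly_Mapping.single 0 c"

definition Var :: "'v \<Rightarrow> 'v real_mpoly" where
  "Var v = Poly_Mapping.single (Poly_Mapping.single v 1) 1"

definition squarefree_monom :: "'v set \<Rightarrow> 'v \<Rightarrow>\<^sub>0 nat" where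
  "squarefree_monom J = (\<Sum>v\<in>J. Poly_Mapping.single v 1)"

text \<open>
  Substitution of \<open>\<sigma> v\<close> for every variable \<open>v\<close>, where \<open>\<phi>\<close> embeds the coefficients into the target
  ring.
\<close>

definition mpoly_subst ::
    "(real \<Rightarrow> 'b::comm_ring_1) \<Rightarrow> ('v \<Rightarrow> 'b) \<Rightarrow> 'v real_mpoly \<Rightarrow> 'b" where
  "mpoly_subst \<phi> \<sigma> p =
     (\<Sum>m\<in>Poly_Mapping.keys p. \<phi> (Poly_Mapping.lookup p m) *
        (\<Prod>v\<in>Poly_Mapping.keys m. \<sigma> v ^ Poly_Mapping.lookup m v))"

text \<open>
  Determinant of a square matrix whose rows and columns are indexed by a finite set (the library
  determinants are indexed by a type or by an initial segment of the natural numbers).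
\<close>

definition det_on :: "'v set \<Rightarrow> ('v \<Rightarrow> 'v \<Rightarrow> 'a::comm_ring_1) \<Rightarrow> 'a" where
  "det_on V A = (\<Sum>p | p permutes V. of_int (sign p) * (\<Prod>i\<in>V. A i (p i)))"

lemma det_on_UNIV: "det_on UNIV (\<lambda>i j. A $ i $ j) = det A"
  by (simp add: det_on_def det_def)

definition id_mat :: "'v \<Rightarrow> 'v \<Rightarrow> 'a::zero_neq_one" where
  "id_mat u v = (if u = v then 1 else 0)"

definition adj_mat :: "('v, 'e) pre_digraph \<Rightarrow> 'v \<Rightarrow> 'v \<Rightarrow> real" where
  "adj_mat G u v = (if u \<rightarrow>\<^bsub>G\<^esub> v then 1 else 0)"

text \<open>\<open>det (\<lambda> Id + \<Delta>\<^sub>n A\<^sub>G)\<close>; left multiplication by \<open>\<Delta>\<^sub>n\<close> scales row \<open>u\<close> by the variable of \<open>u\<close>.\<close>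

definition adj_blowup_poly :: "('v, 'e) pre_digraph \<Rightarrow> real \<Rightarrow> 'v real_mpoly" where
  "adj_blowup_poly G l =
     det_on (verts G) (\<lambda>u v. Const l * id_mat u v + Var u * Const (adj_mat G u v))"

definition adj_blowup_upoly :: "('v, 'e) pre_digraph \<Rightarrow> real \<Rightarrow> real poly" where
  "adj_blowup_upoly G l = mpoly_subst (\<lambda>c. [:c:]) (\<lambda>_. [:0, 1:]) (adj_blowup_poly G l)"

definition adj_char_poly :: "('v, 'e) pre_digraph \<Rightarrow> real poly" where
  "adj_char_poly G = det_on (verts G) (\<lambda>u v. [:0, 1:] * id_mat u v - [:adj_mat G u v:])"

definition connected_component_of ::
    "('v, 'e) pre_digraph \<Rightarrow> ('v, 'e) pre_digraph \<Rightarrow> bool" where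
  "connected_component_of C G \<longleftrightarrow> pre_digraph.max_subgraph G Digraph_Component.connected C"

text \<open>
  \<^const>\<open>pre_digraph.cycle\<close> counts going back and forth along one edge as a cycle (of length 2), so
  \<^const>\<open>Digraph_Component.tree\<close> is not the right notion for symmetric digraphs. The cycles of an
  undirected simple graph are those of length at least 3.
\<close>

definition undirected_tree :: "('v, 'e) pre_digraph \<Rightarrow> bool" where
  "undirected_tree T \<longleftrightarrow>
     Digraph_Component.connected T \<and> \<not> (\<exists>p. pre_digraph.cycle T p \<and> 3 \<le> length p)"

definition perfect_matching :: "('v, 'e) pre_digraph \<Rightarrow> 'v set set \<Rightarrow> bool" where
  "perfect_matching G M \<longleftrightarrow>
     M \<subseteq> {{u, v} |u v. u \<rightarrow>\<^bsub>G\<^esub> v} \<and> (\<forall>v\<in>verts G. \<exists>!e. e \<in> M \<and> v \<in> e)"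

end

theory Submission
  imports Defs "HOL-Combinatorics.Orbits"
begin

text \<open>
  Everything follows from the Leibniz expansion of \<open>det (\<lambda> Id + \<Delta>\<^sub>n A)\<close>, because row \<open>u\<close> of this matrix is
  affine in \<open>n\<^sub>u\<close> and contains no other variable.

  Setting \<open>n\<^sub>v = 0\<close> for the vertices outside an induced subgraph \<open>H\<close> turns their rows into \<open>\<lambda>\<close> times rows
  of the identity. Likewise the coefficient of \<open>n\<^sup>J\<close> is the determinant of the matrix with the rows
  of \<open>A\<close> for the vertices in \<open>J\<close> and those of \<open>\<lambda> Id\<close> elsewhere (\<open>lookup_det_affine_rows\<close>). In both
  cases only permutations fixing the remaining vertices survive (\<open>det_on_scalar_rows\<close>). The first case
  gives the restriction formula; the second shows that the coefficient is
  \<open>\<lambda>\<^bsup>|V - J|\<^esup> det A\<^sub>J\<close>, with \<open>A\<^sub>J\<close> the adjacency matrix of the subgraph induced on \<open>J\<close>. Isomorphic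
  induced subgraphs therefore have equal coefficients, since relabelling rows and columns by the same
  bijection preserves determinants (\<open>det_on_bij_betw\<close>).

  For the vanishing statement no term of the expansion of \<open>det A\<^sub>J\<close> survives. A nonzero term comes from a
  permutation \<open>p\<close> of \<open>J\<close> moving every vertex along an edge, so \<open>p\<close> maps each connected component into
  itself. On a component that is a tree, an orbit of length at least 3 would be a cycle of the graph
  (\<open>permutation_cycle\<close>), and orbits of length 1 are excluded by the absence of loops. Hence \<open>p\<close> is a
  fixed-point free involution along edges there, and its orbits form a perfect matching.

  For \<open>\<lambda> = -1\<close>, the identity \<open>(-z) (z\<^bsup>-1\<^esup> Id - A) = - Id + z A\<close> relates the two univariate
  polynomials, with the scalar \<open>(-1)\<^bsup>|V|\<^esup>\<close>.
\<close>

section \<open>Determinants over a finite index set\<close>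

lemma det_on_cong:
  assumes "\<And>i j. i \<in> V \<Longrightarrow> j \<in> V \<Longrightarrow> A i j = B i j"
  shows "det_on V A = det_on V B"
  unfolding det_on_def
proof (intro sum.cong refl arg_cong2[where f = "(*)"] prod.cong)
  fix p i assume "p \<in> {p. p permutes V}" "i \<in> V"
  then show "A i (p i) = B i (p i)"
    using assms by (simp add: permutes_in_image)
qed

lemma det_on_hom:
  fixes h :: "'a::comm_ring_1 \<Rightarrow> 'b::comm_ring_1"
  assumes one: "h 1 = 1" and add: "\<And>x y. h (x + y) = h x + h y"
    and mult: "\<And>x y. h (x * y) = h x * h y"
  shows "h (det_on V A) = det_on V (\<lambda>i j. h (A i j))"
proof -
  have zero: "h 0 = 0"
    using add[of 0 0] by simp
  have minus: "h (- x) = - h x" for x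
    using add[of "- x" x] zero by (simp add: eq_neg_iff_add_eq_0)
  have sum: "h (sum f S) = (\<Sum>x\<in>S. h (f x))" for f :: "('v \<Rightarrow> 'v) \<Rightarrow> 'a" and S
    by (induction S rule: infinite_finite_induct) (simp_all add: zero add)
  have prod: "h (prod f S) = (\<Prod>x\<in>S. h (f x))" for f :: "'v \<Rightarrow> 'a" and S
    by (induction S rule: infinite_finite_induct) (simp_all add: one mult)
  have sign: "h (of_int (sign p)) = of_int (sign p)" for p :: "'v \<Rightarrow> 'v"
    by (cases p rule: sign_cases) (simp_all add: one minus)
  show ?thesis
    by (simp add: det_on_def sum prod mult sign)
qed

lemma det_on_scale:
  "det_on V (\<lambda>i j. c * A i j) = c ^ card V * det_on V A"
  by (simp add: det_on_def prod.distrib sum_distrib_left mult_ac)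

text \<open>
  Expanding along rows that vanish off the diagonal: a permutation contributes only if it fixes the
  indices of those rows, and the permutations doing so are the permutations of the remaining indices.
\<close>

lemma det_on_scalar_rows:
  assumes "finite V" "J \<subseteq> V"
    and diag: "\<And>i j. i \<in> V - J \<Longrightarrow> j \<in> V \<Longrightarrow> A i j = (if i = j then c else 0)"
  shows "det_on V A = c ^ card (V - J) * det_on J A"
proof -
  have sub: "{p. p permutes J} \<subseteq> {p. p permutes V}"
    using assms(2) by (auto intro: permutes_subset)
  have vanish: "(\<Prod>i\<in>V. A i (p i)) = 0" if p: "p permutes V" "\<not> p permutes J" for p
  proof -
    obtain i where i: "i \<in> V - J" "p i \<noteq> i"
      using permutes_superset[OF p(1), of J] p(2) by blast
    then have "A i (p i) = 0"
      using diag[of i "p i"] i p(1) by (auto simp: permutes_in_image)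
    then show ?thesis
      using i(1) assms(1) by (auto intro: prod_zero)
  qed
  have split: "(\<Prod>i\<in>V. A i (p i)) = c ^ card (V - J) * (\<Prod>i\<in>J. A i (p i))" if "p permutes J" for p
  proof -
    have "(\<Prod>i\<in>V - J. A i (p i)) = (\<Prod>i\<in>V - J. c)"
      using that diag by (intro prod.cong) (auto simp: permutes_not_in)
    then show ?thesis
      using prod.subset_diff[OF assms(2,1), of "\<lambda>i. A i (p i)"] by simp
  qed
  have "det_on V A = (\<Sum>p | p permutes J. of_int (sign p) * (\<Prod>i\<in>V. A i (p i)))"
    unfolding det_on_def
    using sub vanish assms(1) by (intro sum.mono_neutral_right) (auto simp: finite_permutations)
  also have "\<dots> = c ^ card (V - J) * det_on J A"
    by (simp add: det_on_def split sum_distrib_left mult_ac)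
  finally show ?thesis .
qed

text \<open>
  Conjugation by \<open>f\<close> is a sign-preserving bijection between the permutations of \<open>V\<close> and those of \<open>W\<close>
  and matches the terms of the two expansions.
\<close>

lemma det_on_bij_betw:
  assumes "finite V" and f: "bij_betw f V W"
    and A: "\<And>i j. i \<in> V \<Longrightarrow> j \<in> V \<Longrightarrow> A (f i) (f j) = B i j"
  shows "det_on W A = det_on V B"
proof -
  have inj: "inj_on f V" and W: "W = f ` V"
    using f by (auto simp: bij_betw_def)
  have g: "bij_betw (inv_into V f) W V"
    using f by (rule bij_betw_inv_into)
  have inv: "map_permutation W (inv_into V f) (map_permutation V f p) = p" if "p permutes V" for p
    using that f inj by (intro map_permutation_compose_inv) auto
  have inv': "map_permutation V f (map_permutation W (inv_into V f) p) = p" if "p permutes W" for p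
    using that g by (intro map_permutation_compose_inv) (auto simp: W f_inv_into_f)
  show ?thesis
    unfolding det_on_def
  proof (rule sum.reindex_bij_witness[of _ "map_permutation W (inv_into V f)" "map_permutation V f",
        symmetric])
    fix p assume "p \<in> {p. p permutes V}"
    then have p: "p permutes V" by simp
    have "(\<Prod>i\<in>W. A i (map_permutation V f p i)) = (\<Prod>i\<in>V. A (f i) (map_permutation V f p (f i)))"
      unfolding W using inj by (simp add: prod.reindex)
    also have "\<dots> = (\<Prod>i\<in>V. B i (p i))"
      using p by (intro prod.cong refl)
        (auto simp: map_permutation_apply[OF inj] permutes_in_image A)
    finally show "of_int (sign (map_permutation V f p)) * (\<Prod>i\<in>W. A i (map_permutation V f p i))
        = of_int (sign p) * (\<Prod>i\<in>V. B i (p i))"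
      using sign_map_permutation[OF inj p assms(1)] by simp
  qed (use f g inv inv' in \<open>auto intro: map_permutation_permutes\<close>)
qed

section \<open>Substitution and coefficients of multivariate polynomials\<close>

text \<open>
  Additivity compares sums over the supports of \<open>p\<close>, \<open>q\<close> and \<open>p + q\<close>; since cancellation may shrink the
  last support, all three are first rewritten over a common finite set.
\<close>

lemma mpoly_subst_superset:
  assumes "\<phi> 0 = 0" "finite S" "Poly_Mapping.keys p \<subseteq> S"
  shows "mpoly_subst \<phi> \<sigma> p = (\<Sum>m\<in>S. \<phi> (Poly_Mapping.lookup p m) *
           (\<Prod>v\<in>Poly_Mapping.keys m. \<sigma> v ^ Poly_Mapping.lookup m v))"
  unfolding mpoly_subst_def
  using assms by (intro sum.mono_neutral_left) (auto simp: in_keys_iff)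

lemma mpoly_subst_single:
  assumes "\<phi> 0 = 0"
  shows "mpoly_subst \<phi> \<sigma> (Poly_Mapping.single m c) =
           \<phi> c * (\<Prod>v\<in>Poly_Mapping.keys m. \<sigma> v ^ Poly_Mapping.lookup m v)"
  by (subst mpoly_subst_superset[of _ "{m}"]) (use assms in auto)

lemma mpoly_subst_Const:
  assumes "\<phi> 0 = 0"
  shows "mpoly_subst \<phi> \<sigma> (Const c) = \<phi> c"
  using assms by (simp add: Const_def mpoly_subst_single)

lemma mpoly_subst_Var:
  assumes "\<phi> 0 = 0" "\<phi> 1 = 1"
  shows "mpoly_subst \<phi> \<sigma> (Var v) = \<sigma> v"
  using assms by (simp add: Var_def mpoly_subst_single)

lemma mpoly_subst_add:
  assumes "\<phi> 0 = 0" and add: "\<And>x y. \<phi> (x + y) = \<phi> x + \<phi> y"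
  shows "mpoly_subst \<phi> \<sigma> (p + q) = mpoly_subst \<phi> \<sigma> p + mpoly_subst \<phi> \<sigma> q"
proof -
  let ?S = "Poly_Mapping.keys p \<union> Poly_Mapping.keys q"
  have "Poly_Mapping.keys (p + q) \<subseteq> ?S"
    by (rule keys_add)
  then show ?thesis
    using mpoly_subst_superset[of \<phi> ?S, OF assms(1)]
    by (simp add: lookup_add add distrib_right sum.distrib)
qed

lemma monom_subst_add:
  fixes \<sigma> :: "'v \<Rightarrow> 'b::comm_ring_1" and m n :: "'v \<Rightarrow>\<^sub>0 nat"
  shows "(\<Prod>v\<in>Poly_Mapping.keys (m + n). \<sigma> v ^ Poly_Mapping.lookup (m + n) v) =
    (\<Prod>v\<in>Poly_Mapping.keys m. \<sigma> v ^ Poly_Mapping.lookup m v) *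
    (\<Prod>v\<in>Poly_Mapping.keys n. \<sigma> v ^ Poly_Mapping.lookup n v)"
proof -
  let ?S = "Poly_Mapping.keys m \<union> Poly_Mapping.keys n"
  have superset: "(\<Prod>v\<in>Poly_Mapping.keys k. \<sigma> v ^ Poly_Mapping.lookup k v) =
      (\<Prod>v\<in>?S. \<sigma> v ^ Poly_Mapping.lookup k v)" if "Poly_Mapping.keys k \<subseteq> ?S" for k :: "'v \<Rightarrow>\<^sub>0 nat"
    using that by (intro prod.mono_neutral_left) (auto simp: in_keys_iff)
  show ?thesis
    using superset[of m] superset[of n] superset[of "m + n"] keys_add[of m n]
    by (simp add: lookup_add power_add prod.distrib)
qed

lemma update_eq_add_single:
  assumes "n \<notin> Poly_Mapping.keys p"
  shows "Poly_Mapping.update n b p = p + Poly_Mapping.single n b"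
  using assms
  by (intro poly_mapping_eqI) (auto simp: lookup_update lookup_add lookup_single in_keys_iff when_def)

lemma mpoly_subst_mult:
  assumes zero: "\<phi> 0 = 0" and add: "\<And>x y. \<phi> (x + y) = \<phi> x + \<phi> y"
    and mult: "\<And>x y. \<phi> (x * y) = \<phi> x * \<phi> y"
  shows "mpoly_subst \<phi> \<sigma> (p * q) = mpoly_subst \<phi> \<sigma> p * mpoly_subst \<phi> \<sigma> q"
proof -
  let ?s = "mpoly_subst \<phi> \<sigma>"
  have s_zero: "?s 0 = 0"
    by (simp add: mpoly_subst_def)
  note s_add = mpoly_subst_add[of \<phi>, OF zero add]
  have single: "?s (Poly_Mapping.single m a * Poly_Mapping.single n b) =
      ?s (Poly_Mapping.single m a) * ?s (Poly_Mapping.single n b)" for m n a b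
    by (simp add: mult_single mpoly_subst_single zero mult monom_subst_add mult_ac)
  \<comment> \<open>Both sides are additive in each factor, so it is enough to compare them on single terms.\<close>
  have single_left: "?s (Poly_Mapping.single m a * q) = ?s (Poly_Mapping.single m a) * ?s q" for m a q
  proof (induction q rule: update_induct)
    case const
    show ?case by (simp add: s_zero)
  next
    case (update q n b)
    then show ?case
      by (simp add: update_eq_add_single distrib_left s_add single)
  qed
  show ?thesis
  proof (induction p rule: update_induct)
    case const
    show ?case by (simp add: s_zero)
  next
    case (update p n b)
    then show ?case
      by (simp add: update_eq_add_single distrib_right s_add single_left)
  qed
qed

lemma mpoly_subst_one:
  assumes "\<phi> 0 = 0" "\<phi> 1 = 1"
  shows "mpoly_subst \<phi> \<sigma> 1 = 1"
  using mpoly_subst_Const[of \<phi> \<sigma> 1, OF assms(1)] assms(2) by (simp add: Const_def)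

lemma Const_simps:
  "Const 0 = 0" "Const 1 = 1" "Const (a + b) = Const a + Const b" "Const (a * b) = Const a * Const b"
  by (simp_all add: Const_def single_add mult_single)

lemma Const_power: "Const (a ^ n) = Const a ^ n"
  by (induction n) (simp_all add: Const_simps)

lemma Const_prod: "Const (\<Prod>i\<in>S. a i) = (\<Prod>i\<in>S. Const (a i))"
  by (induction S rule: infinite_finite_induct) (simp_all add: Const_simps)

lemma lookup_squarefree_monom:
  assumes "finite J"
  shows "Poly_Mapping.lookup (squarefree_monom J) v = (if v \<in> J then 1 else 0)"
  using assms by (simp add: squarefree_monom_def lookup_sum lookup_single when_def)

lemma squarefree_monom_eq_iff:
  assumes "finite X" "finite Y"
  shows "squarefree_monom X = squarefree_monom Y \<longleftrightarrow> X = Y"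
proof
  assume eq: "squarefree_monom X = squarefree_monom Y"
  have "v \<in> X \<longleftrightarrow> v \<in> Y" for v
    using lookup_squarefree_monom[OF assms(1), of v] lookup_squarefree_monom[OF assms(2), of v]
    unfolding eq by (metis zero_neq_one)
  then show "X = Y" by blast
qed simp

lemma prod_Var_Const:
  assumes "finite X"
  shows "(\<Prod>i\<in>X. Var i * Const (a i)) = Poly_Mapping.single (squarefree_monom X) (\<Prod>i\<in>X. a i)"
  using assms
  by (induction X) (simp_all add: squarefree_monom_def Var_def Const_def mult_single)

text \<open>
  Row \<open>u\<close> is affine in the variable of \<open>u\<close> and contains no other variable, so multiplying out a Leibniz
  term gives one squarefree monomial for each set of rows from which the linear part is chosen. The
  coefficient of
  \<open>n\<^sup>J\<close> therefore takes the linear part of the rows in \<open>J\<close> and the constant part of the other rows.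
\<close>

lemma lookup_det_affine_rows:
  fixes A B :: "'v \<Rightarrow> 'v \<Rightarrow> real"
  assumes fin: "finite V" and "J \<subseteq> V"
  shows "Poly_Mapping.lookup (det_on V (\<lambda>u v. Const (B u v) + Var u * Const (A u v)))
           (squarefree_monom J) = det_on V (\<lambda>u v. if u \<in> J then A u v else B u v)"
proof -
  have finJ: "finite J" and finX: "\<And>X. X \<in> Pow V \<Longrightarrow> finite X"
    using assms by (auto intro: finite_subset)
  have coeff: "Poly_Mapping.lookup (of_int s * (\<Prod>i\<in>V. Const (B i (p i)) + Var i * Const (A i (p i))))
      (squarefree_monom J) = of_int s * (\<Prod>i\<in>V. if i \<in> J then A i (p i) else B i (p i))" for s p
  proof -
    let ?c = "\<lambda>X. (\<Prod>i\<in>X. A i (p i)) * (\<Prod>i\<in>V - X. B i (p i))"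
    have "(\<Prod>i\<in>V. Const (B i (p i)) + Var i * Const (A i (p i))) =
        (\<Sum>X\<in>Pow V. (\<Prod>i\<in>X. Var i * Const (A i (p i))) * (\<Prod>i\<in>V - X. Const (B i (p i))))"
      using prod_add[OF fin, of "\<lambda>i. Var i * Const (A i (p i))" "\<lambda>i. Const (B i (p i))"]
      by (simp add: add.commute)
    also have "\<dots> = (\<Sum>X\<in>Pow V. Poly_Mapping.single (squarefree_monom X) (?c X))"
    proof (rule sum.cong)
      fix X assume X: "X \<in> Pow V"
      have "(\<Prod>i\<in>V - X. Const (B i (p i))) = (Const (\<Prod>i\<in>V - X. B i (p i)) :: 'v real_mpoly)"
        by (simp add: Const_prod)
      then show "(\<Prod>i\<in>X. Var i * Const (A i (p i))) * (\<Prod>i\<in>V - X. Const (B i (p i))) =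
          Poly_Mapping.single (squarefree_monom X) (?c X)"
        by (simp only: prod_Var_Const[OF finX[OF X]]) (simp add: Const_def mult_single)
    qed simp
    finally have "of_int s * (\<Prod>i\<in>V. Const (B i (p i)) + Var i * Const (A i (p i))) =
        (\<Sum>X\<in>Pow V. Poly_Mapping.single (squarefree_monom X) (of_int s * ?c X))"
      by (simp add: sum_distrib_left single_of_int[symmetric] mult_single del: single_of_int)
    then have "Poly_Mapping.lookup (of_int s * (\<Prod>i\<in>V. Const (B i (p i)) + Var i * Const (A i (p i))))
        (squarefree_monom J) = (\<Sum>X\<in>Pow V. if X = J then of_int s * ?c X else 0)"
      using finJ finX
      by (auto simp: lookup_sum lookup_single when_def squarefree_monom_eq_iff intro!: sum.cong)
    also have "\<dots> = of_int s * ?c J"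
      using assms by simp
    also have "?c J = (\<Prod>i\<in>V. if i \<in> J then A i (p i) else B i (p i))"
      using prod.subset_diff[OF assms(2) fin, of "\<lambda>i. if i \<in> J then A i (p i) else B i (p i)"]
      by (simp add: mult.commute)
    finally show ?thesis .
  qed
  show ?thesis
    by (simp add: det_on_def lookup_sum coeff)
qed

section \<open>Coefficients of the adjacency blowup-polynomial\<close>

lemma lookup_adj_blowup_poly:
  assumes "finite (verts G)" "J \<subseteq> verts G"
  shows "Poly_Mapping.lookup (adj_blowup_poly G l) (squarefree_monom J) =
           l ^ card (verts G - J) * det_on J (adj_mat G)"
proof -
  have "adj_blowup_poly G l =
      det_on (verts G) (\<lambda>u v. Const (l * id_mat u v) + Var u * Const (adj_mat G u v))"
    unfolding adj_blowup_poly_def by (rule det_on_cong) (simp add: id_mat_def Const_simps)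
  then have "Poly_Mapping.lookup (adj_blowup_poly G l) (squarefree_monom J) =
      det_on (verts G) (\<lambda>u v. if u \<in> J then adj_mat G u v else l * id_mat u v)"
    by (simp add: lookup_det_affine_rows[OF assms])
  also have "\<dots> = l ^ card (verts G - J) * det_on J (adj_mat G)"
    by (subst det_on_scalar_rows[OF assms, where c = l])
      (auto simp: id_mat_def intro!: arg_cong2[where f = "(*)"] det_on_cong)
  finally show ?thesis .
qed

lemma dominates_iff_arc: "u \<rightarrow>\<^bsub>G\<^esub> v \<longleftrightarrow> (\<exists>e\<in>arcs G. tail G e = u \<and> head G e = v)"
  by (auto simp: arcs_ends_conv)

lemma adj_mat_induced_subgraph:
  assumes "induced_subgraph H G" "u \<in> verts H" "v \<in> verts H"
  shows "adj_mat H u v = adj_mat G u v"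
proof -
  have "u \<rightarrow>\<^bsub>H\<^esub> v \<longleftrightarrow> u \<rightarrow>\<^bsub>G\<^esub> v"
    using assms unfolding dominates_iff_arc
    by (auto simp: induced_subgraph_def subgraph_def compatible_def)
  then show ?thesis
    by (simp add: adj_mat_def)
qed

lemma adj_blowup_poly_induced_subgraph:
  assumes fin: "finite (verts G)" and H: "induced_subgraph H G" and "l \<noteq> 0"
  shows "adj_blowup_poly H l =
           mpoly_subst Const (\<lambda>v. if v \<in> verts G - verts H then 0 else Var v) (adj_blowup_poly G l)
             * Const (l powi (int (card (verts H)) - int (card (verts G))))"
proof -
  let ?\<sigma> = "\<lambda>v. if v \<in> verts G - verts H then 0 else Var v"
  let ?s = "mpoly_subst Const ?\<sigma>"
  let ?d = "card (verts G - verts H)"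
  note zero = Const_simps(1) and one = Const_simps(2)
  have sub: "verts H \<subseteq> verts G"
    using H by (auto simp: induced_subgraph_def subgraph_def)
  note s_hom = mpoly_subst_one[of Const, OF zero one] mpoly_subst_add[of Const, OF zero Const_simps(3)]
    mpoly_subst_mult[of Const, OF zero Const_simps(3,4)]
  have id_mat: "id_mat u v = Const (id_mat u v)" for u v :: 'a
    by (simp add: id_mat_def Const_simps)
  have "?s (adj_blowup_poly G l) = det_on (verts G)
      (\<lambda>u v. Const l * id_mat u v + ?\<sigma> u * Const (adj_mat G u v))"
    unfolding adj_blowup_poly_def
    by (subst det_on_hom[of ?s]; (intro s_hom)?; subst (1 2) id_mat)
      (simp add: s_hom mpoly_subst_Const mpoly_subst_Var Const_simps)
  also have "\<dots> = Const l ^ ?d * det_on (verts H)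
      (\<lambda>u v. Const l * id_mat u v + ?\<sigma> u * Const (adj_mat G u v))"
    by (rule det_on_scalar_rows[OF fin sub]) (simp add: id_mat_def)
  also have "\<dots> = Const (l ^ ?d) * adj_blowup_poly H l"
    unfolding adj_blowup_poly_def Const_power
    by (intro arg_cong2[where f = "(*)"] refl det_on_cong) (simp add: adj_mat_induced_subgraph[OF H])
  finally have subst: "?s (adj_blowup_poly G l) = Const (l ^ ?d) * adj_blowup_poly H l" .
  have "int (card (verts H)) - int (card (verts G)) = - int ?d"
    using card_Diff_subset[OF finite_subset[OF sub fin] sub] card_mono[OF fin sub] by simp
  then have "l ^ ?d * l powi (int (card (verts H)) - int (card (verts G))) = 1"
    using \<open>l \<noteq> 0\<close> by (simp add: power_int_minus)
  then have "Const (l ^ ?d) * Const (l powi (int (card (verts H)) - int (card (verts G)))) = 1"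
    by (simp add: Const_simps(2) Const_simps(4)[symmetric])
  then show ?thesis
    unfolding subst by (metis mult.assoc mult.commute mult_1)
qed

lemma adj_mat_app_iso:
  assumes "pre_digraph.digraph_isomorphism H f" "u \<in> verts H" "v \<in> verts H"
  shows "adj_mat (app_iso f H) (iso_verts f u) (iso_verts f v) = adj_mat H u v"
proof -
  have "wf_digraph H" and inj: "inj_on (iso_verts f) (verts H)"
    using assms(1) by (simp_all add: pre_digraph.digraph_isomorphism_def)
  interpret wf_digraph H by fact
  have "iso_verts f u \<rightarrow>\<^bsub>app_iso f H\<^esub> iso_verts f v \<longleftrightarrow>
      (\<exists>x y. x \<rightarrow>\<^bsub>H\<^esub> y \<and> iso_verts f x = iso_verts f u \<and> iso_verts f y = iso_verts f v)"
    unfolding arcs_ends_app_iso_eq[OF assms(1)] by (force simp: image_iff)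
  also have "\<dots> \<longleftrightarrow> u \<rightarrow>\<^bsub>H\<^esub> v"
    using inj_on_eq_iff[OF inj] assms(2,3) adj_in_verts by metis
  finally have "iso_verts f u \<rightarrow>\<^bsub>app_iso f H\<^esub> iso_verts f v \<longleftrightarrow> u \<rightarrow>\<^bsub>H\<^esub> v" .
  then show ?thesis
    by (simp add: adj_mat_def)
qed

lemma det_adj_mat_iso:
  assumes fin: "finite (verts G)" and H: "induced_subgraph H G" and H': "induced_subgraph H' G"
    and "digraph_iso H H'"
  shows "det_on (verts H) (adj_mat G) = det_on (verts H') (adj_mat G)"
proof -
  obtain f where f: "pre_digraph.digraph_isomorphism H f" and H'_eq: "H' = app_iso f H"
    using assms(4) by (auto simp: digraph_iso_def)
  have "finite (verts H)"
    using H fin by (auto simp: induced_subgraph_def subgraph_def intro: finite_subset)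
  moreover have "bij_betw (iso_verts f) (verts H) (verts H')"
    using f by (simp add: bij_betw_def H'_eq pre_digraph.digraph_isomorphism_def)
  moreover have "adj_mat G (iso_verts f u) (iso_verts f v) = adj_mat G u v"
    if "u \<in> verts H" "v \<in> verts H" for u v
    using that adj_mat_app_iso[OF f] adj_mat_induced_subgraph[OF H]
      adj_mat_induced_subgraph[OF H', of "iso_verts f u" "iso_verts f v"]
    by (simp add: H'_eq)
  ultimately show ?thesis
    by (rule det_on_bij_betw[symmetric])
qed

section \<open>Permutations along the edges of a tree\<close>

text \<open>
  Adding an arc that leaves \<open>u\<close>, together with its head, keeps \<open>C\<close> connected; by maximality nothing new
  has been added.
\<close>

lemma connected_component_closed:
  assumes C: "connected_component_of C G" and u: "u \<in> verts C"
    and e: "e \<in> arcs G" "tail G e = u"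
  shows "e \<in> arcs C" "head G e \<in> verts C"
proof -
  have sub: "subgraph C G" and con: "Digraph_Component.connected C"
    and max: "\<And>C'. subgraph C C' \<Longrightarrow> subgraph C' G \<Longrightarrow> Digraph_Component.connected C' \<Longrightarrow> C' = C"
    using C unfolding connected_component_of_def pre_digraph.max_subgraph_def by blast+
  interpret G: wf_digraph G using sub by (rule subgraphE)
  interpret C: wf_digraph C using sub by (rule subgraphE)
  let ?w = "head G e"
  define C' where
    "C' = \<lparr>verts = insert ?w (verts C), arcs = insert e (arcs C), tail = tail G, head = head G\<rparr>"
  have comp: "tail C = tail G" "head C = head G"
    using sub by (auto simp: subgraph_def compatible_def)
  have wf: "wf_digraph C'"
    using u e C.tail_in_verts C.head_in_verts by unfold_locales (auto simp: C'_def comp)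
  have "subgraph C C'"
    using wf C.wf_digraph by (auto simp: subgraph_def C'_def compatible_def comp)
  moreover have "subgraph C' G"
    using wf sub e G.head_in_verts[OF e(1)] by (auto simp: subgraph_def C'_def compatible_def)
  moreover have "Digraph_Component.connected C'"
  proof -
    let ?R = "rtrancl_on (verts C') ((arcs_ends C')\<^sup>s)"
    have mono: "(arcs_ends C)\<^sup>s \<subseteq> (arcs_ends C')\<^sup>s"
      by (auto simp: symcl_def arcs_ends_conv C'_def comp)
    have old: "(x, y) \<in> ?R" if "x \<in> verts C" "y \<in> verts C" for x y
    proof -
      have "(x, y) \<in> rtrancl_on (verts C) ((arcs_ends C)\<^sup>s)"
        using con that by (simp add: connected_conv)
      then show ?thesis
        by (rule rtrancl_on_mono[rotated -1]) (use mono in \<open>auto simp: C'_def\<close>)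
    qed
    have "(u, ?w) \<in> (arcs_ends C')\<^sup>s" "(?w, u) \<in> (arcs_ends C')\<^sup>s"
      using e by (auto simp: symcl_def arcs_ends_conv C'_def)
    then have new: "(u, ?w) \<in> ?R" "(?w, u) \<in> ?R"
      using u by (auto simp: C'_def intro: rtrancl_on_into_rtrancl_on)
    have "(x, u) \<in> ?R" "(u, x) \<in> ?R" if "x \<in> verts C'" for x
      using that old u new by (auto simp: C'_def)
    then have "(x, y) \<in> ?R" if "x \<in> verts C'" "y \<in> verts C'" for x y
      using that by (meson rtrancl_on_trans)
    then show ?thesis
      by (auto simp: connected_conv C'_def)
  qed
  ultimately have "C' = C"
    by (rule max)
  then have "arcs C' = arcs C" "verts C' = verts C" by simp_all
  then show "e \<in> arcs C" "head G e \<in> verts C"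
    by (auto simp: C'_def)
qed

text \<open>
  The orbit \<open>v, p v, p (p v), \<dots>\<close> is followed up to its first return to \<open>v\<close>, after \<open>k\<close> steps. Its
  vertices are distinct because \<open>k\<close> is minimal, and the two inequalities rule out \<open>k = 1\<close> and \<open>k = 2\<close>.
\<close>

lemma (in wf_digraph) permutation_cycle:
  assumes p: "p permutes J" "finite J" and "v \<in> verts G"
    and step: "\<And>u. u \<in> verts G \<Longrightarrow> u \<rightarrow>\<^bsub>G\<^esub> p u" and v: "p v \<noteq> v" "p (p v) \<noteq> v"
  shows "\<exists>c. cycle c \<and> 3 \<le> length c"
proof -
  define a where "a u = (SOME e. e \<in> arcs G \<and> tail G e = u \<and> head G e = p u)" for u
  have a: "a u \<in> arcs G \<and> tail G (a u) = u \<and> head G (a u) = p u" if "u \<in> verts G" for u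
    unfolding a_def by (rule someI_ex) (use step[OF that] in \<open>auto simp: dominates_iff_arc\<close>)
  define k where "k = (LEAST n. 0 < n \<and> (p ^^ n) v = v)"
  have "v \<in> orbit p v"
    using p by (intro permutation_self_in_orbit) (auto intro: permutes_imp_permutation)
  then obtain n where "0 < n \<and> (p ^^ n) v = v"
    unfolding orbit_altdef by force
  then have k: "0 < k" "(p ^^ k) v = v"
    unfolding k_def by (metis (mono_tags, lifting) LeastI)+
  have least: "(p ^^ n) v \<noteq> v" if "0 < n" "n < k" for n
    using that not_less_Least[of n] unfolding k_def by blast
  have "k \<noteq> 1" "k \<noteq> 2"
    using k(2) v by (auto simp: numeral_2_eq_2)
  define c where "c n = map (\<lambda>i. a ((p ^^ i) v)) [0..<n]" for n
  have verts: "(p ^^ i) v \<in> verts G" for i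
    by (induction i) (use assms(3) in \<open>auto intro: adj_in_verts(2)[OF step]\<close>)
  have walk: "awalk v (c n) ((p ^^ n) v)" for n
  proof (induction n)
    case 0
    show ?case using assms(3) by (simp add: c_def awalk_Nil_iff)
  next
    case (Suc n)
    then show ?case
      using a[OF verts[of n]] verts[of "Suc n"]
      by (auto simp: c_def awalk_simps intro!: awalk_appendI)
  qed
  \<comment> \<open>A cycle may repeat its first vertex only at the end, so distinctness is required of the heads of
    the arcs, that is, of the orbit shifted by one step.\<close>
  have heads: "tl (awalk_verts v (c k)) = map (\<lambda>i. p ((p ^^ i) v)) [0..<k]"
    using walk[of k] k a[OF verts]
    by (subst awalk_verts_conv') (auto simp: awalk_def c_def)
  have "inj_on (\<lambda>i. (p ^^ i) v) {0..<k}"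
    using k(2) least by (intro inj_on_funpow_least) auto
  then have "distinct (tl (awalk_verts v (c k)))"
    unfolding heads using permutes_inj[OF p(1)]
    by (auto simp: distinct_map inj_on_def)
  then have "cycle (c k)"
    unfolding cycle_def using walk[of k] k by (auto simp: c_def)
  moreover have "3 \<le> length (c k)"
    using k \<open>k \<noteq> 1\<close> \<open>k \<noteq> 2\<close> by (simp add: c_def)
  ultimately show ?thesis by blast
qed

lemma perfect_matching_of_involution:
  assumes step: "\<And>v. v \<in> verts C \<Longrightarrow> v \<rightarrow>\<^bsub>C\<^esub> p v" and invol: "\<And>v. v \<in> verts C \<Longrightarrow> p (p v) = v"
  shows "perfect_matching C ((\<lambda>v. {v, p v}) ` verts C)"
  unfolding perfect_matching_def
proof (intro conjI ballI)
  show "(\<lambda>v. {v, p v}) ` verts C \<subseteq> {{u, v} |u v. u \<rightarrow>\<^bsub>C\<^esub> v}"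
    using step by blast
  fix v assume v: "v \<in> verts C"
  show "\<exists>!e. e \<in> (\<lambda>v. {v, p v}) ` verts C \<and> v \<in> e"
  proof (rule ex1I[of _ "{v, p v}"])
    fix e assume "e \<in> (\<lambda>v. {v, p v}) ` verts C \<and> v \<in> e"
    then obtain u where "u \<in> verts C" "e = {u, p u}" "v = u \<or> v = p u" by auto
    then show "e = {v, p v}"
      using invol by auto
  qed (use v in auto)
qed

text \<open>
  Not only the determinant but each term of its expansion vanishes: a permutation of \<open>J\<close> with a nonzero
  term restricts to the component \<open>C\<close>, where the absence of cycles makes it a matching.
\<close>

lemma det_adj_mat_tree_component:
  assumes "graph G" and J: "J \<subseteq> verts G" and C: "connected_component_of C (G \<restriction> J)"
    and tree: "undirected_tree C" and no_matching: "\<nexists>M. perfect_matching C M"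
  shows "det_on J (adj_mat G) = 0"
proof -
  interpret G: graph G by fact
  have finJ: "finite J" using J by (rule finite_subset) simp
  have sub: "subgraph C (G \<restriction> J)"
    using C unfolding connected_component_of_def pre_digraph.max_subgraph_def by blast
  interpret C: wf_digraph C using sub by (rule subgraphE)
  have CJ: "verts C \<subseteq> J" and comp: "tail C = tail G" "head C = head G"
    using sub by (auto simp: subgraph_def compatible_def)
  have "(\<Prod>i\<in>J. adj_mat G i (p i)) = 0" if p: "p permutes J" for p
  proof (rule ccontr)
    assume "(\<Prod>i\<in>J. adj_mat G i (p i)) \<noteq> 0"
    then have adj: "i \<rightarrow>\<^bsub>G\<^esub> p i" if "i \<in> J" for i
      using that finJ by (auto simp: adj_mat_def split: if_splits)
    have step: "v \<rightarrow>\<^bsub>C\<^esub> p v" and moves: "p v \<noteq> v" if v: "v \<in> verts C" for v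
    proof -
      obtain e where e: "e \<in> arcs G" "tail G e = v" "head G e = p v"
        using adj[of v] v CJ by (auto simp: dominates_iff_arc)
      then have "e \<in> arcs (G \<restriction> J)"
        using v CJ p by (auto simp: permutes_in_image)
      then have "e \<in> arcs C"
        using connected_component_closed(1)[OF C v] e by simp
      then show "v \<rightarrow>\<^bsub>C\<^esub> p v"
        using e by (auto simp: dominates_iff_arc comp)
      show "p v \<noteq> v"
        using G.no_loops[OF e(1)] e by auto
    qed
    have "p (p v) = v" if "v \<in> verts C" for v
      using C.permutation_cycle[OF p finJ that step moves[OF that]] tree
      by (auto simp: undirected_tree_def)
    then show False
      using perfect_matching_of_involution[OF step] no_matching by blast
  qed
  then show ?thesis
    by (simp add: det_on_def)
qed

section \<open>The univariate specialization\<close>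

lemma poly_adj_blowup_upoly:
  "poly (adj_blowup_upoly G l) z = det_on (verts G) (\<lambda>u v. l * id_mat u v + z * adj_mat G u v)"
proof -
  let ?\<phi> = "\<lambda>c::real. [:c:]" and ?\<sigma> = "\<lambda>_. [:0, 1:]"
  let ?s = "\<lambda>q. poly (mpoly_subst ?\<phi> ?\<sigma> q) z"
  have zero: "?\<phi> 0 = 0" and one: "?\<phi> 1 = 1" and add: "\<And>x y. ?\<phi> (x + y) = ?\<phi> x + ?\<phi> y"
    and mult: "\<And>x y. ?\<phi> (x * y) = ?\<phi> x * ?\<phi> y"
    by auto
  note s_hom = mpoly_subst_one[of ?\<phi> ?\<sigma>, OF zero one] mpoly_subst_add[of ?\<phi> ?\<sigma>, OF zero add]
    mpoly_subst_mult[of ?\<phi> ?\<sigma>, OF zero add mult]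
  have id_mat: "id_mat u v = Const (id_mat u v)" for u v :: 'a
    by (simp add: id_mat_def Const_simps)
  have "poly (adj_blowup_upoly G l) z = ?s (adj_blowup_poly G l)"
    by (simp add: adj_blowup_upoly_def)
  also have "\<dots> = det_on (verts G)
      (\<lambda>u v. ?s (Const l * id_mat u v + Var u * Const (adj_mat G u v)))"
    unfolding adj_blowup_poly_def by (rule det_on_hom[of ?s]) (simp_all add: s_hom)
  also have "\<dots> = det_on (verts G) (\<lambda>u v. l * id_mat u v + z * adj_mat G u v)"
    by (subst id_mat) (simp add: s_hom mpoly_subst_Const mpoly_subst_Var mult.commute)
  finally show ?thesis .
qed

lemma poly_adj_char_poly:
  "poly (adj_char_poly G) x = det_on (verts G) (\<lambda>u v. x * id_mat u v - adj_mat G u v)"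
  unfolding adj_char_poly_def
  by (subst det_on_hom[of "\<lambda>q. poly q x"]) (auto simp: id_mat_def intro!: det_on_cong)

lemma adj_blowup_upoly_char_poly:
  assumes "z \<noteq> 0"
  shows "poly (adj_blowup_upoly G (- 1)) z =
           (- 1) ^ card (verts G) * (z ^ card (verts G) * poly (adj_char_poly G) (inverse z))"
proof -
  have "(- 1) ^ card (verts G) * (z ^ card (verts G) * poly (adj_char_poly G) (inverse z)) =
      (- z) ^ card (verts G) * poly (adj_char_poly G) (inverse z)"
    by (simp add: power_minus[of z])
  also have "\<dots> = det_on (verts G) (\<lambda>u v. (- z) * (inverse z * id_mat u v - adj_mat G u v))"
    by (simp only: poly_adj_char_poly det_on_scale)
  also have "\<dots> = det_on (verts G) (\<lambda>u v. (- 1) * id_mat u v + z * adj_mat G u v)"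
    using assms by (intro det_on_cong) (simp add: algebra_simps)
  finally show ?thesis
    by (simp add: poly_adj_blowup_upoly)
qed

section \<open>Restriction, coefficients and spectrum of the adjacency blowup-polynomial\<close>

theorem proposition4p1:
  fixes G :: "('v, 'e) pre_digraph" and l :: real
  assumes "graph G" and "Digraph_Component.connected G" and "l \<noteq> 0"
  shows
    "(\<forall>H. induced_subgraph H G \<longrightarrow>
        adj_blowup_poly H l =
          mpoly_subst Const (\<lambda>v. if v \<in> verts G - verts H then 0 else Var v) (adj_blowup_poly G l)
            * Const (l powi (int (card (verts H)) - int (card (verts G))))) \<and>
     (\<forall>H H'. induced_subgraph H G \<longrightarrow> induced_subgraph H' G \<longrightarrow> digraph_iso H H' \<longrightarrow>
        Poly_Mapping.lookup (adj_blowup_poly G l) (squarefree_monom (verts H)) =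
        Poly_Mapping.lookup (adj_blowup_poly G l) (squarefree_monom (verts H'))) \<and>
     (\<forall>J C. J \<noteq> {} \<longrightarrow> J \<subseteq> verts G \<longrightarrow> connected_component_of C (G \<restriction> J) \<longrightarrow>
        undirected_tree C \<longrightarrow> \<not> (\<exists>M. perfect_matching C M) \<longrightarrow>
        Poly_Mapping.lookup (adj_blowup_poly G l) (squarefree_monom J) = 0) \<and>
     (l = - 1 \<longrightarrow>
        (\<exists>c. c \<noteq> 0 \<and> (\<forall>z. z \<noteq> 0 \<longrightarrow>
           poly (adj_blowup_upoly G l) z =
             c * (z ^ card (verts G) * poly (adj_char_poly G) (inverse z)))))"
proof -
  interpret graph G by fact
  have fin: "finite (verts G)" by simp
  show ?thesis
  proof (intro conjI allI impI)
    fix H assume "induced_subgraph H G"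
    then show "adj_blowup_poly H l =
        mpoly_subst Const (\<lambda>v. if v \<in> verts G - verts H then 0 else Var v) (adj_blowup_poly G l)
          * Const (l powi (int (card (verts H)) - int (card (verts G))))"
      using fin assms(3) by (intro adj_blowup_poly_induced_subgraph)
  next
    fix H H' assume H: "induced_subgraph H G" and H': "induced_subgraph H' G" and iso: "digraph_iso H H'"
    have sub: "verts H \<subseteq> verts G" "verts H' \<subseteq> verts G"
      using H H' by (auto simp: induced_subgraph_def subgraph_def)
    obtain f where f: "pre_digraph.digraph_isomorphism H f" "H' = app_iso f H"
      using iso by (auto simp: digraph_iso_def)
    have "card (verts H') = card (verts H)"
      using f by (simp add: card_image pre_digraph.digraph_isomorphism_def)
    then have "card (verts G - verts H) = card (verts G - verts H')"
      using sub fin by (simp add: card_Diff_subset finite_subset)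
    then show "Poly_Mapping.lookup (adj_blowup_poly G l) (squarefree_monom (verts H)) =
        Poly_Mapping.lookup (adj_blowup_poly G l) (squarefree_monom (verts H'))"
      using det_adj_mat_iso[OF fin H H' iso] sub fin by (simp add: lookup_adj_blowup_poly)
  next
    fix J C assume "J \<subseteq> verts G" "connected_component_of C (G \<restriction> J)" "undirected_tree C"
      "\<not> (\<exists>M. perfect_matching C M)"
    then show "Poly_Mapping.lookup (adj_blowup_poly G l) (squarefree_monom J) = 0"
      using fin by (simp add: lookup_adj_blowup_poly det_adj_mat_tree_component[OF assms(1)])
  next
    assume "l = - 1"
    then show "\<exists>c. c \<noteq> 0 \<and> (\<forall>z. z \<noteq> 0 \<longrightarrow> poly (adj_blowup_upoly G l) z =
        c * (z ^ card (verts G) * poly (adj_char_poly G) (inverse z)))"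
      by (intro exI[of _ "(- 1) ^ card (verts G)"]) (simp add: adj_blowup_upoly_char_poly)
  qed
qed

end
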